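(* Let $n=2m+1=p$ be an odd prime number and $1\le j\le m$. Then $$\left\{p^{\left\lfloor\frac{r-1}{m}\right\rfloor}\mathscr{F}_r^{(m,j)}\right\}_{r=-\infty}^{+\infty}=\left\{\mathscr{N}_r^{(m,j)}\right\}_{r=-\infty}^{+\infty},$$ so that $p^{\left\lfloor\frac{r-1}{m}\right\rfloor}\mathscr{F}_r^{(m,j)}\in\mathbb{Z}$ for all $r\in\mathbb{Z}$.
   Context: Rational interlacing Fibonacci sequences of dimension $m\ge1$. Let $h_k=\frac1{2k+1}\binom{m+k}{2k}$ and let $R_m$ be the $m\times m$ matrix whose first column is $(-h_1,-h_2,\dots,-h_m)^T$, whose entries $(i,i+1)$, $1\le i\le m-1$, equal $1$, and whose other entries are $0$ (it is invertible). Let $B_{\rm odd}$ be the $m\times m$ matrix with $(i,j)$ entry $(-1)^{i+j-1}\binom{2j-1}{j-i}$ (binomial coefficients with negative lower entry are $0$). For $r\in\mathbb{Z}$ and $1\le j\le m$, $\mathscr{F}_r^{(m,j)}$ is the $(j,1)$ entry of $(2m+1)B_{\rm odd}R_m^{r}$. For $n=2m+1=p$ prime, $\mathscr{N}_r^{(m,j)}$ is defined by $\mathscr{N}_r^{(m,j)}=p^{\lfloor (r-1)/q\rfloor}\mathscr{F}_r^{(m,j)}$ with $q=(p-1)/2=m$ for $r>0$, and by $\mathscr{N}_r^{(m,j)}=p^{\vartheta}\mathscr{F}_r^{(m,j)}$ with $\vartheta=-1-\left\lfloor\frac{-2r}{p-1}\right\rfloor$ for $r\le0$. *)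

theory Defs
  imports
    "Jordan_Normal_Form.Matrix"
    "HOL-Computational_Algebra.Primes"
begin

(* Library matrices are indexed from 0; this lets entries be given by 1-based indices. *)
definition mat1 :: "nat \<Rightarrow> (nat \<Rightarrow> nat \<Rightarrow> 'a) \<Rightarrow> 'a mat" where
  "mat1 m f = mat m m (\<lambda>(i, j). f (Suc i) (Suc j))"

definition h :: "nat \<Rightarrow> nat \<Rightarrow> rat" where
  "h m k = 1 / of_nat (2 * k + 1) * of_nat ((m + k) choose (2 * k))"

definition R_mat :: "nat \<Rightarrow> rat mat" where
  "R_mat m = mat1 m (\<lambda>i j. if j = 1 then - h m i else if j = i + 1 then 1 else 0)"

(* The test i \<le> j is needed because j - i is truncated subtraction and n choose 0 = 1. *)
definition B_odd :: "nat \<Rightarrow> rat mat" where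
  "B_odd m = mat1 m (\<lambda>i j.
     if i \<le> j then (-1) ^ (i + j - 1) * of_nat ((2 * j - 1) choose (j - i)) else 0)"

(* Integer powers are those of the multiplicative monoid of m x m matrices. For negative
   exponents they use the monoid inverse, meaningful by R_mat_Units below. *)
definition R_pow :: "nat \<Rightarrow> int \<Rightarrow> rat mat" where
  "R_pow m r = R_mat m [^]\<^bsub>ring_mat TYPE(rat) m ()\<^esub> r"

definition F_seq :: "nat \<Rightarrow> nat \<Rightarrow> int \<Rightarrow> rat" where
  "F_seq m j r = (of_nat (2 * m + 1) \<cdot>\<^sub>m (B_odd m * R_pow m r)) $$ (j - 1, 0)"

(* Intended for 2 * m + 1 prime. *)
definition N_seq :: "nat \<Rightarrow> nat \<Rightarrow> int \<Rightarrow> rat" where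
  "N_seq m j r =
     (let p = of_nat (2 * m + 1) :: rat; q = (p - 1) / 2 in
      if r > 0 then p powi \<lfloor>(of_int r - 1) / q\<rfloor> * F_seq m j r
      else p powi (- 1 - \<lfloor>- 2 * of_int r / (p - 1)\<rfloor>) * F_seq m j r)"

lemma R_mat_Units:
  assumes "1 \<le> m"
  shows "R_mat m \<in> Units (ring_mat TYPE(rat) m ())"
proof -
  define S :: "rat mat" where "S = mat1 m (\<lambda>i j.
    if j = m then - h m (i - 1) / h m m else if i = j + 1 then 1 else 0)"
  have hm: "h m m \<noteq> 0" and h0: "h m 0 = 1"
    by (simp_all add: h_def add_eq_0_iff flip: mult_2)
  have carr: "R_mat m \<in> carrier_mat m m" "S \<in> carrier_mat m m"
    by (simp_all add: R_mat_def S_def mat1_def)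
  have RS: "R_mat m * S = 1\<^sub>m m"
  proof (rule eq_matI)
    fix i k assume "i < dim_row (1\<^sub>m m :: rat mat)" "k < dim_col (1\<^sub>m m :: rat mat)"
    hence ik: "i < m" "k < m" by auto
    have "(R_mat m * S) $$ (i, k) = (\<Sum>l<m. R_mat m $$ (i, l) * S $$ (l, k))"
      using carr ik by (simp add: scalar_prod_def atLeast0LessThan)
    also have "\<dots> = (\<Sum>l<m. (if l = 0 then - h m (Suc i) * S $$ (0, k) else 0) +
                     (if l = Suc i then S $$ (Suc i, k) else 0))"
      by (rule sum.cong) (use ik in \<open>auto simp: R_mat_def mat1_def\<close>)
    also have "\<dots> = - h m (Suc i) * S $$ (0, k) + (if Suc i < m then S $$ (Suc i, k) else 0)"
      using ik by (simp add: sum.distrib sum.delta)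
    also have "\<dots> = (1\<^sub>m m) $$ (i, k)"
    proof (cases "Suc i = m")
      case True
      thus ?thesis using ik hm h0 by (auto simp: S_def mat1_def)
    next
      case False
      hence "Suc i < m" using ik by simp
      thus ?thesis using ik hm h0 by (auto simp: S_def mat1_def)
    qed
    finally show "(R_mat m * S) $$ (i, k) = (1\<^sub>m m) $$ (i, k)" .
  qed (use carr in auto)
  have SR: "S * R_mat m = 1\<^sub>m m"
  proof (rule eq_matI)
    fix i k assume "i < dim_row (1\<^sub>m m :: rat mat)" "k < dim_col (1\<^sub>m m :: rat mat)"
    hence ik: "i < m" "k < m" by auto
    have "(S * R_mat m) $$ (i, k) = (\<Sum>l<m. S $$ (i, l) * R_mat m $$ (l, k))"
      using carr ik by (simp add: scalar_prod_def atLeast0LessThan)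
    also have "\<dots> = (\<Sum>l<m. (if l = m - 1 then - h m i / h m m * R_mat m $$ (m - 1, k) else 0) +
                     (if Suc l = i then R_mat m $$ (i - 1, k) else 0))"
      by (rule sum.cong) (use ik in \<open>auto simp: S_def mat1_def\<close>)
    also have "\<dots> = - h m i / h m m * R_mat m $$ (m - 1, k)
                 + (if i > 0 then R_mat m $$ (i - 1, k) else 0)"
    proof (cases i)
      case 0
      thus ?thesis using ik by (simp add: sum.distrib sum.delta)
    next
      case (Suc i')
      thus ?thesis using ik by (simp add: sum.distrib sum.delta)
    qed
    also have "\<dots> = (1\<^sub>m m) $$ (i, k)"
      using ik hm h0 by (cases i) (auto simp: R_mat_def mat1_def)
    finally show "(S * R_mat m) $$ (i, k) = (1\<^sub>m m) $$ (i, k)" .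
  qed (use carr in auto)
  show ?thesis
    unfolding Units_def using carr RS SR by (auto simp: ring_mat_simps)
qed

end

theory Submission
  imports Defs "HOL-Algebra.Multiplicative_Group"
begin

text \<open>
  Write $p = 2m+1$. Since the first column of $R_m$ is $-(h_1,\dots,h_m)^T$ and the rest of
  $R_m$ only moves columns one place to the right, every entry of the first column of
  $A R_m^r$, as a function of $r$, satisfies the recurrence
  $f_r = -\sum_{k=1}^{m} h_k f_{r-k}$, and its values at
  $r = 0, -1, \dots, -(m-1)$ are the entries of a row of $A$
  (lemmas \<open>R_pow_shift\<close> and \<open>R_pow_recurrence\<close>). For $A = p B_{\rm odd}$ these
  initial values are $p$ times integers.

  When $p$ is prime, $h_1, \dots, h_{m-1}$ are integers and $h_m = 1/p$
  (\<open>h_in_Ints\<close>, \<open>h_top\<close>), so the only denominator comes from the term $m$ places back.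
  The exponent $\lfloor (r-1)/m \rfloor$ grows by exactly one in $m$ steps, so
  multiplying the recurrence by $p^{\lfloor (r-1)/m \rfloor}$ turns the outer terms
  $f_r$ and $h_m f_{r-m}$ into the scaled values at $r$ and $r-m$, both with coefficient 1,
  and the terms between them into integer multiples of scaled values. Integrality of $m$
  consecutive scaled values therefore propagates both to the right and to the left
  (\<open>scaled_recurrence_in_Ints\<close>).

  The two sequences agree because $-1-\lfloor -r/m \rfloor = \lfloor (r-1)/m \rfloor$
  for every integer $r$.
\<close>

section \<open>Integer powers of $R_m$\<close>

lemma (in monoid) int_pow_add_one_Units:
  assumes "x \<in> Units G"
  shows "x [^] (r + 1 :: int) = x [^] r \<otimes> x"
proof (cases "r \<ge> 0")
  case True
  then obtain n where "r = int n"
    using nonneg_int_cases by blast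
  moreover from this have "r + 1 = int (Suc n)"
    by simp
  ultimately show ?thesis
    using int_pow_int nat_pow_Suc by metis
next
  case False
  define n where "n = nat (- r - 1)"
  have r: "r = - int (Suc n)" and r1: "r + 1 = - int n"
    using False by (simp_all add: n_def)
  have carr: "x \<in> carrier G" and pow_unit: "x [^] n \<in> Units G"
    using assms Units_pow_closed by auto
  have pos: "x [^] (- int k) = inv (x [^] k)" for k
    by (cases "k = 0") (simp_all add: int_pow_def2)
  have "inv (x \<otimes> x [^] n) = inv (x [^] n) \<otimes> inv x"
  proof (rule inv_char)
    have "(x \<otimes> x [^] n) \<otimes> (inv (x [^] n) \<otimes> inv x)
        = x \<otimes> (x [^] n \<otimes> inv (x [^] n)) \<otimes> inv x"
      using assms pow_unit carr by (simp add: m_assoc del: Units_r_inv)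
    then show "(x \<otimes> x [^] n) \<otimes> (inv (x [^] n) \<otimes> inv x) = \<one>"
      using assms pow_unit carr by simp
    have "(inv (x [^] n) \<otimes> inv x) \<otimes> (x \<otimes> x [^] n)
        = inv (x [^] n) \<otimes> ((inv x \<otimes> x) \<otimes> x [^] n)"
      using assms pow_unit carr by (simp add: m_assoc del: Units_l_inv)
    then show "(inv (x [^] n) \<otimes> inv x) \<otimes> (x \<otimes> x [^] n) = \<one>"
      using assms pow_unit carr by simp
  qed (use assms pow_unit carr in simp_all)
  then have "x [^] r \<otimes> x = inv (x [^] n) \<otimes> inv x \<otimes> x"
    unfolding r pos nat_pow_Suc2[OF carr] by simp
  also have "\<dots> = x [^] (r + 1)"
    unfolding r1 pos using assms pow_unit carr by (simp add: m_assoc)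
  finally show ?thesis ..
qed

lemma R_pow_carrier:
  assumes "1 \<le> m"
  shows "R_pow m r \<in> carrier_mat m m"
proof -
  interpret M: ring "ring_mat TYPE(rat) m ()" by (rule ring_mat)
  have "R_mat m [^]\<^bsub>ring_mat TYPE(rat) m ()\<^esub> r \<in> carrier (ring_mat TYPE(rat) m ())"
    unfolding int_pow_def2
    using M.Units_pow_closed[OF R_mat_Units[OF assms]] M.Units_closed M.Units_inv_closed by presburger
  then show ?thesis
    by (simp add: R_pow_def ring_mat_simps)
qed

lemma R_pow_0: "R_pow m 0 = 1\<^sub>m m"
  by (simp add: R_pow_def int_pow_def2 ring_mat_simps)

lemma R_pow_add_one:
  assumes "1 \<le> m"
  shows "R_pow m (r + 1) = R_pow m r * R_mat m"
proof -
  interpret M: ring "ring_mat TYPE(rat) m ()" by (rule ring_mat)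
  show ?thesis
    using M.int_pow_add_one_Units[OF R_mat_Units[OF assms]]
    by (simp add: R_pow_def ring_mat_simps)
qed

lemma mult_R_mat_index:
  assumes "X \<in> carrier_mat n m" and "a < n" and "s < m"
  shows "(X * R_mat m) $$ (a, s) =
           (if s = 0 then - (\<Sum>l<m. h m (Suc l) * X $$ (a, l)) else X $$ (a, s - 1))"
proof -
  have "(X * R_mat m) $$ (a, s) = (\<Sum>l<m. X $$ (a, l) * R_mat m $$ (l, s))"
    using assms by (simp add: R_mat_def mat1_def scalar_prod_def atLeast0LessThan)
  also have "\<dots> = (\<Sum>l<m. if s = 0 then - (h m (Suc l) * X $$ (a, l))
                          else if l = s - 1 then X $$ (a, l) else 0)"
    by (rule sum.cong) (use assms in \<open>auto simp: R_mat_def mat1_def\<close>)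
  also have "\<dots> = (if s = 0 then - (\<Sum>l<m. h m (Suc l) * X $$ (a, l)) else X $$ (a, s - 1))"
    using assms by (auto simp: sum_negf)
  finally show ?thesis .
qed

text \<open>
  Multiplying by $R_m$ moves column $s-1$ to column $s$, so all columns of $A R_m^r$ are
  first columns of products with earlier powers. At $r = 0$ this reads off the
  initial values of the sequence at $0, -1, \dots, -(m-1)$ as a row of $A$.
\<close>

lemma R_pow_shift:
  assumes "A \<in> carrier_mat n m" and "a < n" and "s < m"
  shows "(A * R_pow m r) $$ (a, s) = (A * R_pow m (r - int s)) $$ (a, 0)"
  using assms(3)
proof (induction s arbitrary: r)
  case (Suc s)
  have m: "1 \<le> m" using Suc.prems by simp
  have "A * R_pow m r = A * R_pow m (r - 1) * R_mat m"
    using R_pow_add_one[OF m, of "r - 1"] assms(1) R_pow_carrier[OF m]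
    by (simp add: assoc_mult_mat[of _ n m _ m _ m] R_mat_def mat1_def)
  then have "(A * R_pow m r) $$ (a, Suc s) = (A * R_pow m (r - 1)) $$ (a, s)"
    using mult_R_mat_index[of "A * R_pow m (r - 1)" n m a "Suc s"] Suc.prems assms(1,2)
      R_pow_carrier[OF m] by simp
  also have "\<dots> = (A * R_pow m (r - 1 - int s)) $$ (a, 0)"
    using Suc by simp
  finally show ?case
    by (simp add: algebra_simps)
qed simp

lemma R_pow_recurrence:
  assumes "A \<in> carrier_mat n m" and "a < n" and "1 \<le> m"
  shows "(A * R_pow m r) $$ (a, 0) =
           - (\<Sum>l<m. h m (Suc l) * (A * R_pow m (r - 1 - int l)) $$ (a, 0))"
proof -
  have "A * R_pow m r = A * R_pow m (r - 1) * R_mat m"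
    using R_pow_add_one[OF assms(3), of "r - 1"] assms(1) R_pow_carrier[OF assms(3)]
    by (simp add: assoc_mult_mat[of _ n m _ m _ m] R_mat_def mat1_def)
  then have "(A * R_pow m r) $$ (a, 0) = - (\<Sum>l<m. h m (Suc l) * (A * R_pow m (r - 1)) $$ (a, l))"
    using mult_R_mat_index[of "A * R_pow m (r - 1)" n m a 0] assms
      R_pow_carrier[OF assms(3)] by simp
  also have "\<dots> = - (\<Sum>l<m. h m (Suc l) * (A * R_pow m (r - 1 - int l)) $$ (a, 0))"
  proof (intro arg_cong[where f = uminus] sum.cong refl)
    fix l assume "l \<in> {..<m}"
    then have "(A * R_pow m (r - 1)) $$ (a, l) = (A * R_pow m (r - 1 - int l)) $$ (a, 0)"
      by (intro R_pow_shift[OF assms(1,2)]) simp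
    then show "h m (Suc l) * (A * R_pow m (r - 1)) $$ (a, l) =
        h m (Suc l) * (A * R_pow m (r - 1 - int l)) $$ (a, 0)"
      by (rule arg_cong)
  qed
  finally show ?thesis .
qed

section \<open>Arithmetic of the coefficients\<close>

text \<open>
  By absorption, $\frac{2m+1}{2k+1}\binom{m+k}{2k} = \binom{m+k}{2k} + 2\binom{m+k}{2k+1}$,
  so $2k+1$ divides $(2m+1)\binom{m+k}{2k}$; as $2k+1$ is smaller than the prime $2m+1$, it
  divides the binomial coefficient itself.
\<close>

lemma h_in_Ints:
  assumes "prime (2 * m + 1)" and "k < m"
  shows "h m k \<in> \<int>"
proof -
  let ?C = "(m + k) choose (2 * k)"
  have absorb: "(2 * k + 1) * ((m + k) choose (2 * k + 1)) = (m - k) * ?C"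
    using binomial_absorb_comp[of "m + k" "2 * k"] binomial_absorption[of "2 * k" "m + k"]
    by (metis Suc_eq_plus1 add_diff_cancel_right mult_2)
  have "2 * m + 1 = (2 * k + 1) + 2 * (m - k)"
    using assms(2) by simp
  then have "(2 * m + 1) * ?C = (2 * k + 1) * ?C + 2 * ((m - k) * ?C)"
    by (metis distrib_right mult.assoc)
  then have "2 * k + 1 dvd (2 * m + 1) * ?C"
    unfolding absorb[symmetric] by (metis dvd_add dvd_mult dvd_triv_left)
  moreover have "coprime (2 * k + 1) (2 * m + 1)"
  proof -
    have "\<not> 2 * m + 1 dvd 2 * k + 1"
      using assms(2) by (intro nat_dvd_not_less) simp_all
    then show ?thesis
      using prime_imp_coprime[OF assms(1)] coprime_commute by blast
  qed
  ultimately have "2 * k + 1 dvd ?C"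
    using coprime_dvd_mult_right_iff by blast
  then obtain q where "?C = (2 * k + 1) * q" ..
  then have "h m k = of_nat q"
    unfolding h_def by (simp only: of_nat_mult) (simp del: of_nat_Suc of_nat_add of_nat_mult)
  then show ?thesis by simp
qed

lemma h_top: "h m m = 1 / of_nat (2 * m + 1)"
  by (simp add: h_def flip: mult_2)

section \<open>Integrality of the scaled sequence\<close>

text \<open>
  A recurrence of order $m$ in which the last coefficient $1/c$ is the only source of denominators.
  The \<open>balance\<close> equation in the proof is symmetric in its two ends, which is why the same
  argument extends integrality forwards and backwards.
\<close>

lemma scaled_recurrence_in_Ints:
  fixes f :: "int \<Rightarrow> 'a :: field_char_0" and b :: "nat \<Rightarrow> 'a" and c :: 'a
  assumes c: "c \<in> \<int>" "c \<noteq> 0" and m: "1 \<le> m"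
    and recur: "\<And>r. f r = - (\<Sum>l<m. b l * f (r - 1 - int l))"
    and b: "\<And>l. Suc l < m \<Longrightarrow> b l \<in> \<int>" and top: "b (m - 1) = 1 / c"
    and init: "\<And>s. s < m \<Longrightarrow> f (- int s) / c \<in> \<int>"
  shows "c powi ((r - 1) div int m) * f r \<in> \<int>"
proof -
  define E where "E r = (r - 1) div int m" for r
  define g where "g r = c powi E r * f r" for r
  have E_shift: "E r = E (r - int m) + 1" for r
    using m div_add_self2[of "int m" "r - int m - 1"] by (simp add: E_def)
  (* E is monotone, so the scaling factor of a later index also clears denominators. *)
  have weaken: "c powi E r * f s \<in> \<int>" if "s \<le> r" "g s \<in> \<int>" for r s
  proof -
    have "E s \<le> E r"
      using that m by (simp add: E_def zdiv_mono1)
    then have "c powi E r = c ^ nat (E r - E s) * c powi E s"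
      using c by (simp flip: power_int_of_nat power_int_add)
    then show ?thesis
      using that c by (simp add: g_def mult.assoc)
  qed
  (* At r - m the exponent is one less than at r, which cancels the coefficient 1 / c. *)
  have balance: "g r + (\<Sum>l<m - 1. b l * (c powi E r * f (r - 1 - int l))) + g (r - int m) = 0"
    for r
  proof -
    obtain d where d: "m = Suc d" using m by (cases m) auto
    define S where "S = (\<Sum>l<d. b l * f (r - 1 - int l))"
    define z where "z = f (r - int m) / c"
    have "f r = - (S + z)"
      using recur[of r] top by (simp add: d S_def z_def diff_diff_eq)
    moreover have "f (r - int m) = c * z"
      using c by (simp add: z_def)
    moreover have "c powi E r = c * c powi E (r - int m)"
      using c E_shift[of r] by (simp add: power_int_add)
    ultimately have "g r + c powi E r * S + g (r - int m) = 0"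
      by (simp only: g_def) (simp add: algebra_simps)
    moreover have "(\<Sum>l<d. b l * (c powi E r * f (r - 1 - int l))) = c powi E r * S"
      by (simp add: S_def sum_distrib_left mult.left_commute)
    ultimately show ?thesis
      by (simp only: d diff_Suc_1)
  qed
  have cross: "g r \<in> \<int> \<longleftrightarrow> g (r - int m) \<in> \<int>"
    if window: "\<And>l. Suc l < m \<Longrightarrow> g (r - 1 - int l) \<in> \<int>" for r
  proof -
    define T where "T = (\<Sum>l<m - 1. b l * (c powi E r * f (r - 1 - int l)))"
    have "T \<in> \<int>"
      unfolding T_def
    proof (intro Ints_sum)
      fix l assume "l \<in> {..<m - 1}"
      then have l: "Suc l < m" by simp
      have "c powi E r * f (r - 1 - int l) \<in> \<int>"
        by (rule weaken) (use window[OF l] in simp_all)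
      with b[OF l] show "b l * (c powi E r * f (r - 1 - int l)) \<in> \<int>"
        by (rule Ints_mult)
    qed
    moreover have "g r + T + g (r - int m) = 0"
      unfolding T_def by (rule balance)
    then have "g r = - (T + g (r - int m))" "g (r - int m) = - (g r + T)"
      by (simp_all only: eq_neg_iff_add_eq_0 ac_simps)
    ultimately show ?thesis
      by (metis Ints_add Ints_minus)
  qed
  have "\<forall>s<m. g (r - int s) \<in> \<int>" for r
  proof (induction r rule: int_induct[where k = 0])
    case base
    (* The exponent is -1 on the initial window, hence the division by c in the hypothesis. *)
    have "E (- int s) = - 1" if "s < m" for s
      unfolding E_def using that by (intro int_div_pos_eq[where r = "int m - 1 - int s"]) auto
    then show ?case
      using init by (simp add: g_def power_int_minus divide_inverse mult.commute)
  next
    case (step1 r)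
    have window: "g (r - int s) \<in> \<int>" if "s < m" for s
      using step1(2) that by blast
    have "g (r + 1 - int m) \<in> \<int>"
      using window[of "m - 1"] m by (simp add: of_nat_diff algebra_simps)
    then have new: "g (r + 1) \<in> \<int>"
      using cross[of "r + 1"] window by simp
    show ?case
    proof (intro allI impI)
      fix s assume "s < m"
      then show "g (r + 1 - int s) \<in> \<int>"
        using new window by (cases s) auto
    qed
  next
    case (step2 r)
    have window: "g (r - int s) \<in> \<int>" if "s < m" for s
      using step2(2) that by blast
    have shifted: "g (r - 1 - int s) \<in> \<int>" if "Suc s < m" for s
      using window[OF that] by (simp add: diff_diff_eq)
    have "g r \<in> \<int>"
      using window[of 0] m by simp
    then have new: "g (r - int m) \<in> \<int>"
      using cross[OF shifted] by simp
    show ?case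
    proof (intro allI impI)
      fix s assume "s < m"
      then consider "s = m - 1" | "Suc s < m" by linarith
      then show "g (r - 1 - int s) \<in> \<int>"
      proof cases
        case 1
        then show ?thesis using new m by (simp add: of_nat_diff)
      qed (rule shifted)
    qed
  qed
  then have "g (r - int 0) \<in> \<int>"
    using m by (metis less_eq_Suc_le One_nat_def)
  then show ?thesis
    by (simp add: g_def E_def)
qed

lemma scaled_F_seq_in_Ints:
  assumes "prime (2 * m + 1)" and j: "1 \<le> j" "j \<le> m"
  shows "(of_nat (2 * m + 1) :: rat) powi ((r - 1) div int m) * F_seq m j r \<in> \<int>"
proof (rule scaled_recurrence_in_Ints)
  let ?p = "of_nat (2 * m + 1) :: rat"
  have m: "1 \<le> m" and j': "j - 1 < m" using j by auto
  have B: "B_odd m \<in> carrier_mat m m"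
    by (simp add: B_odd_def mat1_def)
  have F: "F_seq m j r = ?p * (B_odd m * R_pow m r) $$ (j - 1, 0)" for r
    using B R_pow_carrier[OF m, of r] m j' by (simp add: F_seq_def)
  show "F_seq m j r = - (\<Sum>l<m. h m (Suc l) * F_seq m j (r - 1 - int l))" for r
    unfolding F by (subst R_pow_recurrence[OF B j' m])
      (simp add: sum_distrib_left mult_ac del: of_nat_add of_nat_mult of_nat_Suc)
  show "h m (Suc l) \<in> \<int>" if "Suc l < m" for l
    using h_in_Ints assms(1) that by blast
  show "h m (Suc (m - 1)) = 1 / ?p"
    using h_top m by simp
  show "F_seq m j (- int s) / ?p \<in> \<int>" if "s < m" for s
  proof -
    have "F_seq m j (- int s) / ?p = (B_odd m * R_pow m 0) $$ (j - 1, s)"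
      unfolding F R_pow_shift[OF B j' that] by simp
    also have "\<dots> = B_odd m $$ (j - 1, s)"
      using B by (simp add: R_pow_0)
    also have "\<dots> \<in> \<int>"
      using that j' by (simp add: B_odd_def mat1_def)
    finally show ?thesis .
  qed
  show "?p \<in> \<int>"
    by (rule Ints_of_nat)
  show "?p \<noteq> 0"
    unfolding of_nat_eq_0_iff by simp
  show "1 \<le> m"
    by (rule m)
qed

theorem mainTheorem11:
  fixes m n p j :: nat
  assumes "n = 2 * m + 1" and "n = p" and "prime p" and "odd p"
    and "1 \<le> j" and "j \<le> m"
  shows "(\<lambda>r::int. (of_nat p :: rat) powi \<lfloor>(of_int r - 1) / (of_nat m :: rat)\<rfloor> * F_seq m j r)
           = (\<lambda>r::int. N_seq m j r)
       \<and> (\<forall>r::int. (of_nat p :: rat) powi \<lfloor>(of_int r - 1) / (of_nat m :: rat)\<rfloor> * F_seq m j r \<in> \<int>)"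
proof -
  have p: "p = 2 * m + 1" using assms by simp
  have m: "m > 0" using assms by simp
  have fl: "\<lfloor>(of_int r - 1) / (of_nat m :: rat)\<rfloor> = (r - 1) div int m" for r :: int
    using floor_divide_of_int_eq[of "r - 1" "int m", where ?'a = rat] by simp
  have fl': "\<lfloor>- 2 * of_int r / (of_nat (2 * m + 1) - 1 :: rat)\<rfloor> = (- r) div int m" for r :: int
    using floor_divide_of_int_eq[of "- r" "int m", where ?'a = rat] m by simp
  have half: "(of_nat (2 * m + 1) - 1) / 2 = (of_nat m :: rat)"
    by simp
  have ceil: "- 1 - (- r) div int m = (r - 1) div int m" for r
  proof -
    have "- r = int m * (- 1 - (r - 1) div int m) + (int m - 1 - (r - 1) mod int m)"
      using mult_div_mod_eq[of "int m" "r - 1"] by (simp add: algebra_simps)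
    moreover have "0 \<le> int m - 1 - (r - 1) mod int m" "int m - 1 - (r - 1) mod int m < int m"
      using m pos_mod_bound[of "int m" "r - 1"] pos_mod_sign[of "int m" "r - 1"] by linarith+
    ultimately have "(- r) div int m = - 1 - (r - 1) div int m"
      by (rule int_div_pos_eq)
    then show ?thesis by simp
  qed
  have "of_nat p powi ((r - 1) div int m) * F_seq m j r = N_seq m j r" for r
    unfolding N_seq_def Let_def half fl fl' ceil p by simp
  moreover have "of_nat p powi ((r - 1) div int m) * F_seq m j r \<in> \<int>" for r
    using scaled_F_seq_in_Ints[of m j r] assms p by simp
  ultimately show ?thesis
    unfolding fl by blast
qed

end
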